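(* Let $\mathcal N=(D,s,t)$ be a network with $D=(V,E)$ a finite directed graph, and let $V^\circ=V\setminus\{s,t\}$. Let $\mathcal P$ be a finite multiset of $s$–$t$ paths in $D$ with $|\mathcal P|=|V^\circ|$. If $\mathcal P$ is not regimented, then there exists a $\mathcal P$-multicolored $s$–$t$ path.
   Context: A network is a triple $(D,s,t)$ where $D=(V,E)$ is a directed graph and $s,t\in V$ are distinct vertices such that no edge of $D$ enters $s$ and no edge leaves $t$. Paths are directed paths without repeated vertices; $E(P)$ is the edge set of $P$. Two $s$–$t$ paths are innerly disjoint if they share no vertex other than $s$ and $t$. A path $Q$ is $\mathcal P$-multicolored if there is an injective map assigning to each edge $e\in E(Q)$ a member of the multiset $\mathcal P$ (members counted with multiplicity) that contains $e$; i.e. distinct edges of $Q$ lie on distinct members of $\mathcal P$. The multiset $\mathcal P$ is regimented if there exist pairwise innerly disjoint $s$–$t$ paths $P_1,\ldots,P_k$ such that $\mathcal P$ consists exactly of $|E(P_j)|-1$ copies of $P_j$ for each $j=1,\ldots,k$. *)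

theory Defs
  imports "Graph_Theory.Digraph" "Graph_Theory.Arc_Walk" "HOL-Library.Multiset"
begin

text \<open>
  An edge set E contained in V x V has no parallel edges, hence \<open>nomulti_digraph\<close>; loops and
  antiparallel edges are allowed, and finiteness is not part of the notion. Paths are lists of
  arcs: \<open>apath s p t\<close> says that \<open>p\<close> is a directed s-t path without repeated vertices, with edge
  set \<open>set p\<close> and vertex set \<open>set (awalk_verts s p)\<close>.
\<close>

locale network = nomulti_digraph G
  for G :: "('a, 'b) pre_digraph" (structure) +
  fixes s t :: 'a
  assumes source_in_verts: "s \<in> verts G"
    and sink_in_verts: "t \<in> verts G"
    and source_neq_sink: "s \<noteq> t"
    and no_arc_enters_source: "in_arcs G s = {}"
    and no_arc_leaves_sink: "out_arcs G t = {}"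
begin

definition innerly_disjoint :: "'b awalk \<Rightarrow> 'b awalk \<Rightarrow> bool" where
  "innerly_disjoint p q \<longleftrightarrow> set (awalk_verts s p) \<inter> set (awalk_verts s q) \<subseteq> {s, t}"

text \<open>
  The case of no paths at all is included: the empty multiset is regimented.
\<close>

definition regimented :: "'b awalk multiset \<Rightarrow> bool" where
  "regimented \<P> \<longleftrightarrow>
    (\<exists>ps. (\<forall>p \<in> set ps. apath s p t) \<and>
          (\<forall>i < length ps. \<forall>j < length ps. i \<noteq> j \<longrightarrow> innerly_disjoint (ps ! i) (ps ! j)) \<and>
          \<P> = (\<Sum>p\<leftarrow>ps. replicate_mset (card (set p) - 1) p))"

end

text \<open>
  The members of a multiset, counted with multiplicity, are represented by the pairs \<open>(p, i)\<close>
  with \<open>i < count \<P> p\<close>; an edge is mapped to such a pair whose path \<open>p\<close> contains it.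
\<close>

definition multicolored :: "'b awalk multiset \<Rightarrow> 'b awalk \<Rightarrow> bool" where
  "multicolored \<P> q \<longleftrightarrow>
    (\<exists>f :: 'b \<Rightarrow> 'b awalk \<times> nat. inj_on f (set q) \<and>
       (\<forall>e \<in> set q. snd (f e) < count \<P> (fst (f e)) \<and> e \<in> set (fst (f e))))"

end

theory Submission
  imports Defs
begin

text \<open>
  Suppose that there is no multicolored path, and let \<open>R A\<close> be the set of vertices reachable from
  \<open>s\<close> by walks whose edges have distinct colors from \<open>A\<close>. A path \<open>c \<notin> A\<close> leaves \<open>R A\<close>, so adding
  \<open>c\<close> enlarges \<open>R A\<close>; as there are as many colors as inner vertices, it does so by exactly one
  vertex, the exit of \<open>c\<close> from \<open>A\<close>. Whether two unused paths have the same exit turns out not to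
  depend on \<open>A\<close>. Letting \<open>A\<close> grow from \<open>{}\<close> to all colors but these two, one finds that the two
  paths coincide if their exits agree, and are innerly disjoint otherwise. Then no path can occur
  as often as it has edges, and counting inner vertices forces the multiplicities.
\<close>

section \<open>Reachability growing by one vertex per color\<close>

lemma split_at_first_exit:
  assumes "xs \<noteq> []" "hd xs \<in> S" "last xs \<notin> S"
  obtains ys u w zs where "xs = ys @ u # w # zs" "set ys \<subseteq> S" "u \<in> S" "w \<notin> S"
proof -
  have "\<exists>ys u w zs. xs = ys @ u # w # zs \<and> set ys \<subseteq> S \<and> u \<in> S \<and> w \<notin> S"
    using assms
  proof (induction xs)
    case (Cons a xs)
    then obtain b xs' where xs: "xs = b # xs'" by (cases xs) auto
    show ?case
    proof (cases "b \<in> S")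
      case True
      then obtain ys u w zs where "xs = ys @ u # w # zs" "set ys \<subseteq> S" "u \<in> S" "w \<notin> S"
        using Cons xs by auto
      then have "a # xs = (a # ys) @ u # w # zs" "set (a # ys) \<subseteq> S" "u \<in> S" "w \<notin> S"
        using Cons.prems by auto
      then show ?thesis by blast
    next
      case False
      then have "a # xs = [] @ a # b # xs'" "set [] \<subseteq> S" "a \<in> S" "b \<notin> S"
        using Cons.prems xs by auto
      then show ?thesis by blast
    qed
  qed simp
  then show thesis using that by blast
qed

text \<open>Abstracts a counterexample: \<open>reach_subset\<close> keeps \<open>t\<close> out of
  every \<open>R A\<close>, which is the absence of a multicolored path, and
  \<open>reach_step\<close> appends an edge of a fresh color. Copies of a path are different colors
  with the same \<open>verts_of\<close>.\<close>

locale stalled_growth =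
  fixes V :: "'v set" and s t :: 'v
    and C :: "'c set" and verts_of :: "'c \<Rightarrow> 'v list" and R :: "'c set \<Rightarrow> 'v set"
  assumes finite_V: "finite V"
    and finite_C: "finite C"
    and s_neq_t: "s \<noteq> t"
    and t_in_V: "t \<in> V"
    and card_C: "card C = card (V - {s, t})"
    and path_nonempty: "c \<in> C \<Longrightarrow> verts_of c \<noteq> []"
    and path_hd: "c \<in> C \<Longrightarrow> hd (verts_of c) = s"
    and path_last: "c \<in> C \<Longrightarrow> last (verts_of c) = t"
    and path_distinct: "c \<in> C \<Longrightarrow> distinct (verts_of c)"
    and path_V: "c \<in> C \<Longrightarrow> set (verts_of c) \<subseteq> V"
    and reach_source: "A \<subseteq> C \<Longrightarrow> s \<in> R A"
    and reach_subset: "A \<subseteq> C \<Longrightarrow> R A \<subseteq> V - {t}"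
    and reach_mono: "A \<subseteq> B \<Longrightarrow> B \<subseteq> C \<Longrightarrow> R A \<subseteq> R B"
    and reach_step: "A \<subseteq> C \<Longrightarrow> c \<in> C - A \<Longrightarrow> verts_of c = ys @ u # w # zs \<Longrightarrow> u \<in> R A
      \<Longrightarrow> w \<in> R (insert c A)"
begin

section \<open>Tight growth of the reach\<close>

lemma finite_reach: "A \<subseteq> C \<Longrightarrow> finite (R A)"
  using reach_subset finite_V by (meson finite_Diff finite_subset)

lemma t_notin_reach: "A \<subseteq> C \<Longrightarrow> t \<notin> R A"
  using reach_subset by blast

lemma first_exit:
  assumes "A \<subseteq> C" "c \<in> C - A"
  obtains ys u w zs where "verts_of c = ys @ u # w # zs" "set ys \<subseteq> R A" "u \<in> R A" "w \<notin> R A"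
  using split_at_first_exit[of "verts_of c" "R A"] assms path_nonempty path_hd path_last
    reach_source t_notin_reach by (metis DiffD1)

lemma reach_psubset:
  assumes "A \<subseteq> C" "c \<in> C - A"
  shows "R A \<subset> R (insert c A)"
proof -
  obtain ys u w zs where "verts_of c = ys @ u # w # zs" "u \<in> R A" "w \<notin> R A"
    using first_exit[OF assms] by metis
  then have "w \<in> R (insert c A) - R A" using reach_step assms by blast
  then show ?thesis using reach_mono[of A "insert c A"] assms by blast
qed

lemma card_reach_growth:
  assumes "finite D" "A \<inter> D = {}" "A \<union> D \<subseteq> C"
  shows "card (R A) + card D \<le> card (R (A \<union> D))"
  using assms
proof (induction D)
  case (insert d D)
  have "card (R (A \<union> D)) < card (R (insert d (A \<union> D)))"
    using insert by (intro psubset_card_mono finite_reach reach_psubset) auto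
  then show ?case using insert by simp
qed simp

lemma card_V: "card (V - {t}) = Suc (card C)"
proof -
  have "s \<in> V" using reach_source[of C] reach_subset[of C] by auto
  then have "V - {t} = insert s (V - {s, t})" using s_neq_t by auto
  then have "card (V - {t}) = card (insert s (V - {s, t}))" by (rule arg_cong)
  then show ?thesis using card_C finite_V by simp
qed

text \<open>Growth from \<open>{}\<close> to \<open>A\<close> gives the lower bound. Growth from
  \<open>A\<close> to \<open>C\<close> gives the upper bound, since \<open>R C\<close> lies in
  \<open>V - {t}\<close>, which has only \<open>card C + 1\<close> elements.\<close>

lemma card_reach:
  assumes "A \<subseteq> C"
  shows "card (R A) = Suc (card A)"
proof (rule antisym)
  have s: "s \<in> R {}" using reach_source by simp
  have "card (R A) + card (C - A) \<le> card (R C)"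
    using card_reach_growth[of "C - A" A] assms finite_C by (simp add: Un_absorb1)
  moreover have "card (R C) \<le> Suc (card C)"
    using card_mono[OF _ reach_subset[of C]] card_V finite_V by simp
  moreover have "card (C - A) + card A = card C"
    using assms finite_C by (simp add: card_Diff_subset card_mono finite_subset)
  ultimately show "card (R A) \<le> Suc (card A)" by linarith
  have "card (R {}) \<noteq> 0" using s finite_reach[of "{}"] by auto
  then show "Suc (card A) \<le> card (R A)"
    using card_reach_growth[of A "{}"] assms finite_C finite_subset by fastforce
qed

lemma reach_empty: "R {} = {s}"
  using card_reach[of "{}"] reach_source[of "{}"] by (auto simp: card_Suc_eq)

lemma reach_all: "R C = V - {t}"
  using card_subset_eq[of "V - {t}" "R C"] card_V card_reach reach_subset finite_V by simp

definition exit :: "'c \<Rightarrow> 'c set \<Rightarrow> 'v" where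
  "exit c A = hd (dropWhile (\<lambda>v. v \<in> R A) (verts_of c))"

lemma exit_eqI:
  assumes "verts_of c = ys @ w # zs" "set ys \<subseteq> R A" "w \<notin> R A"
  shows "exit c A = w"
proof -
  have "dropWhile (\<lambda>v. v \<in> R A) (ys @ w # zs) = w # zs"
    using assms by (simp add: dropWhile_append subset_code(1) dropWhile_append2)
  then show ?thesis unfolding exit_def assms(1) by simp
qed

lemma exit_cong: "R A = R B \<Longrightarrow> exit c A = exit c B"
  by (simp add: exit_def)

text \<open>By \<open>card_reach\<close> the color \<open>c\<close> adds exactly one vertex, so a
  single new vertex accounts for the whole gain.\<close>

lemma reach_insert_new:
  assumes "A \<subseteq> C" "c \<in> C - A" "v \<in> R (insert c A)" "v \<notin> R A"
  shows "R (insert c A) = insert v (R A)"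
proof -
  have sub: "insert v (R A) \<subseteq> R (insert c A)"
    using assms reach_mono[of A "insert c A"] by blast
  have "card (R (insert c A)) = card (insert v (R A))"
    using assms card_reach finite_reach finite_C by (simp add: finite_subset)
  then show ?thesis
    using card_subset_eq[OF _ sub] finite_reach assms by (metis DiffD1 insert_subset)
qed

text \<open>Leaving \<open>R A\<close> twice would add two vertices, so every unused path meets \<open>R A\<close> in an
  initial segment.\<close>

lemma exit_split:
  assumes "A \<subseteq> C" "c \<in> C - A"
  obtains ys zs where "verts_of c = ys @ exit c A # zs" "set ys \<subseteq> R A" "exit c A \<notin> R A"
    "set zs \<inter> R A = {}" "R (insert c A) = insert (exit c A) (R A)"
proof -
  obtain ys u w zs where xc: "verts_of c = ys @ u # w # zs"
    and ys: "set ys \<subseteq> R A" "u \<in> R A" "w \<notin> R A"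
    using first_exit[OF assms] by metis
  have ex: "exit c A = w" using exit_eqI[of c "ys @ [u]" w zs A] xc ys by simp
  have "w \<in> R (insert c A)" using reach_step xc ys assms by blast
  then have ins: "R (insert c A) = insert w (R A)" using reach_insert_new assms ys by blast
  have "set zs \<inter> R A = {}"
  proof (rule ccontr)
    assume "set zs \<inter> R A \<noteq> {}"
    then obtain z as bs where z: "zs = as @ z # bs" "z \<in> R A"
      by (metis disjoint_iff split_list)
    have "last (z # bs) = t" using path_last[of c] assms xc z by simp
    then obtain ys' u' w' zs' where s: "z # bs = ys' @ u' # w' # zs'" "u' \<in> R A" "w' \<notin> R A"
      using split_at_first_exit[of "z # bs" "R A"] z t_notin_reach assms by (metis list.sel(1) list.distinct(1))
    have "verts_of c = (ys @ u # w # as @ ys') @ u' # w' # zs'" using xc z s by simp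
    then have "w' \<in> R (insert c A)" "w' \<noteq> w"
      using reach_step[of A c _ u' w' zs'] s assms path_distinct[of c] by auto
    then show False using ins s by blast
  qed
  then show thesis using that[of "ys @ [u]" zs] xc ys ex ins by simp
qed

lemma exit_notin_reach: "A \<subseteq> C \<Longrightarrow> c \<in> C - A \<Longrightarrow> exit c A \<notin> R A"
  by (erule exit_split)

lemma reach_insert: "A \<subseteq> C \<Longrightarrow> c \<in> C - A \<Longrightarrow> R (insert c A) = insert (exit c A) (R A)"
  by (erule exit_split)

lemma exit_on_path: "A \<subseteq> C \<Longrightarrow> c \<in> C - A \<Longrightarrow> exit c A \<in> set (verts_of c)"
  by (erule exit_split) auto

text \<open>If the exits differed, adding \<open>r\<close> would leave the exit of \<open>c\<close>
  in place but put a vertex of \<open>c\<close> beyond it into the reach, against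
  \<open>exit_split\<close>.\<close>

lemma exit_eq_if_on_path:
  assumes "A \<subseteq> C" "c \<in> C - A" "r \<in> C - A" "c \<noteq> r" "exit r A \<in> set (verts_of c)"
  shows "exit c A = exit r A"
proof (rule ccontr)
  assume neq: "exit c A \<noteq> exit r A"
  obtain ys zs where xc: "verts_of c = ys @ exit c A # zs" "set ys \<subseteq> R A" "exit c A \<notin> R A"
    using exit_split[OF assms(1,2)] .
  have ins: "R (insert r A) = insert (exit r A) (R A)" using reach_insert assms by blast
  have "exit r A \<in> set zs" using xc assms neq exit_notin_reach[of A r] by auto
  have "exit c (insert r A) = exit c A" using exit_eqI[of c ys] xc ins neq by blast
  moreover have "insert r A \<subseteq> C" "c \<in> C - insert r A" using assms by auto
  ultimately obtain ys' zs' where xc': "verts_of c = ys' @ exit c A # zs'"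
    "set zs' \<inter> R (insert r A) = {}"
    by (metis exit_split)
  \<comment> \<open>Since vertices are distinct, the path splits at its exit in only one
    way.\<close>
  moreover have "exit c A \<notin> set ys" "exit c A \<notin> set zs"
    using xc(1) path_distinct[of c] assms by auto
  ultimately have "zs' = zs"
    using xc(1) append_Cons_eq_iff[of "exit c A" ys zs ys' zs'] by simp
  then show False using xc' ins \<open>exit r A \<in> set zs\<close> by blast
qed

section \<open>Exits after adding a color\<close>

lemma exit_insert_other:
  assumes "A \<subseteq> C" "c \<in> C - A" "r \<in> C - A" "exit r A \<noteq> exit c A"
  shows "exit c (insert r A) = exit c A"
proof -
  obtain ys zs where "verts_of c = ys @ exit c A # zs" "set ys \<subseteq> R A" "exit c A \<notin> R A"
    using exit_split[OF assms(1,2)] .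
  moreover have "R (insert r A) = insert (exit r A) (R A)" using reach_insert[OF assms(1,3)] .
  ultimately show ?thesis
    using assms(4) by (intro exit_eqI[of c ys "exit c A" zs]) auto
qed

text \<open>Adding either color first yields the same reach, and adding both yields the same set in
  either order. The second color adds a single vertex, so it is the same one.\<close>

lemma exit_swap:
  assumes "A \<subseteq> C" "p \<in> C - A" "q \<in> C - A" "p \<noteq> q" "exit p A = exit q A"
  shows "exit p (insert q A) = exit q (insert p A)"
proof -
  have "R (insert p A) = R (insert q A)" using reach_insert assms by metis
  moreover have "R (insert p (insert q A)) = insert (exit p (insert q A)) (R (insert q A))"
    "R (insert q (insert p A)) = insert (exit q (insert p A)) (R (insert p A))"
    "exit p (insert q A) \<notin> R (insert q A)"
    using assms exit_notin_reach[of "insert q A" p] by (auto intro!: reach_insert)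
  ultimately show ?thesis by (metis insert_commute insert_iff)
qed

text \<open>If the new exit of \<open>p\<close> were that of \<open>q\<close>, then adding \<open>q\<close> to \<open>A\<close> instead of \<open>r\<close> would reach
  a vertex of \<open>p\<close> beyond its exit from \<open>A\<close>.\<close>

lemma exit_insert_neq:
  assumes "A \<subseteq> C" "p \<in> C - A" "q \<in> C - A" "r \<in> C - A" "p \<noteq> q" "p \<noteq> r" "q \<noteq> r"
    and neq: "exit p A \<noteq> exit q A" and r: "exit r A = exit p A"
  shows "exit p (insert r A) \<noteq> exit q (insert r A)"
proof
  assume eq: "exit p (insert r A) = exit q (insert r A)"
  have "exit q (insert r A) = exit q A" using exit_insert_other assms by metis
  moreover have "exit p (insert r A) \<in> set (verts_of p)"
    using exit_on_path[of "insert r A" p] assms by auto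
  ultimately show False using exit_eq_if_on_path[of A p q] eq assms by simp
qed

lemma exit_eq_insert_iff:
  assumes "A \<subseteq> C" "p \<in> C - A" "q \<in> C - A" "r \<in> C - A" "p \<noteq> q" "p \<noteq> r" "q \<noteq> r"
  shows "exit p (insert r A) = exit q (insert r A) \<longleftrightarrow> exit p A = exit q A"
proof (cases "exit p A = exit q A")
  case True
  show ?thesis
  proof (cases "exit r A = exit p A")
    case r: True
    \<comment> \<open>All three colors add the same vertex, so \<open>r\<close> may be replaced by
      \<open>q\<close> or \<open>p\<close> and \<open>exit_swap\<close> applies.\<close>
    then have "R (insert r A) = R (insert q A)" "R (insert r A) = R (insert p A)"
      using True reach_insert assms by metis+
    then show ?thesis using exit_swap[of A p q] True assms exit_cong by metis
  next
    case False
    then show ?thesis using True exit_insert_other assms by metis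
  qed
next
  case False
  \<comment> \<open>The exit of \<open>r\<close> agrees with at most one of the two. If with one,
    \<open>exit_insert_neq\<close> applies; if with neither, both exits stay put.\<close>
  show ?thesis
    using exit_insert_neq[of A p q r] exit_insert_neq[of A q p r] exit_insert_other[of A p r]
      exit_insert_other[of A q r] False assms by metis
qed

text \<open>Agreement of exits becomes a fixed relation between colors: it can be tested at
  \<open>{}\<close> and used at \<open>C - {p, q}\<close>.\<close>

lemma exit_eq_iff:
  assumes "A \<subseteq> C" "p \<in> C - A" "q \<in> C - A" "p \<noteq> q"
  shows "exit p A = exit q A \<longleftrightarrow> exit p {} = exit q {}"
proof -
  have "finite A" using assms finite_C finite_subset by blast
  then show ?thesis
    using assms
  proof (induction A)
    case (insert r A)
    then show ?case using exit_eq_insert_iff[of A p q r] by auto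
  qed simp
qed

section \<open>Agreeing exits force equal paths\<close>

text \<open>While \<open>A\<close> grows, the paths either advance together through their common
  exit or both avoid the new vertex.\<close>

lemma common_prefix:
  assumes "A \<subseteq> C" "p \<in> C - A" "q \<in> C - A" "p \<noteq> q" "exit p {} = exit q {}"
  shows "\<exists>ys ps qs. verts_of p = ys @ ps \<and> verts_of q = ys @ qs \<and>
    set ys \<subseteq> R A \<and> set ps \<inter> R A = {} \<and> set qs \<inter> R A = {}"
proof -
  have "finite A" using assms finite_C finite_subset by blast
  then show ?thesis
    using assms
  proof (induction A)
    case empty
    have *: "\<exists>zs. verts_of c = [s] @ zs \<and> set zs \<inter> R {} = {}" if "c \<in> C" for c
      using path_nonempty[OF that] path_hd[OF that] path_distinct[OF that] reach_empty
      by (cases "verts_of c") auto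
    obtain ps qs where "verts_of p = [s] @ ps" "set ps \<inter> R {} = {}"
      "verts_of q = [s] @ qs" "set qs \<inter> R {} = {}"
      using *[of p] *[of q] empty by auto
    moreover have "set [s] \<subseteq> R {}" using reach_empty by simp
    ultimately show ?case by blast
  next
    case (insert r A)
    then obtain ys ps qs where ih: "verts_of p = ys @ ps" "verts_of q = ys @ qs"
      "set ys \<subseteq> R A" "set ps \<inter> R A = {}" "set qs \<inter> R A = {}" by auto
    have e: "exit p A = exit q A" using exit_eq_iff[of A p q] insert by auto
    \<comment> \<open>The prefix is reached and the rest is not, so the rest begins with the exit;
      it is nonempty as \<open>t\<close> is never reached.\<close>
    have split: "\<exists>cs'. cs = exit c A # cs' \<and> exit c A \<notin> set cs'"
      if c: "verts_of c = ys @ cs" "set cs \<inter> R A = {}" "c \<in> C - A" for c cs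
    proof -
      have "cs \<noteq> []" using c path_last[of c] path_nonempty[of c] t_notin_reach ih insert.prems
        by (metis Diff_iff append_Nil2 insert_subset last_in_set subsetD)
      then obtain w cs' where cs: "cs = w # cs'" by (cases cs) auto
      then have "exit c A = w" using exit_eqI[of c ys w cs' A] c ih by auto
      then show ?thesis using path_distinct[of c] c cs by auto
    qed
    obtain ps' where ps: "ps = exit p A # ps'" "exit p A \<notin> set ps'"
      using split[of p ps] ih insert.prems by auto
    obtain qs' where qs: "qs = exit p A # qs'" "exit p A \<notin> set qs'"
      using split[of q qs] ih insert.prems e by auto
    have ins: "R (insert r A) = insert (exit r A) (R A)"
      using reach_insert[of A r] insert by auto
    show ?case
    proof (cases "exit r A = exit p A")
      case True
      have "verts_of p = (ys @ [exit p A]) @ ps'" "verts_of q = (ys @ [exit p A]) @ qs'"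
        "set (ys @ [exit p A]) \<subseteq> R (insert r A)" "set ps' \<inter> R (insert r A) = {}"
        "set qs' \<inter> R (insert r A) = {}"
        using ih ps qs ins True by auto
      then show ?thesis by blast
    next
      case False
      then have "exit r A \<notin> set (verts_of p)" "exit r A \<notin> set (verts_of q)"
        using exit_eq_if_on_path[of A p r] exit_eq_if_on_path[of A q r] e insert by auto
      then have "set ys \<subseteq> R (insert r A)" "set ps \<inter> R (insert r A) = {}"
        "set qs \<inter> R (insert r A) = {}"
        using ih ins by auto
      then show ?thesis using ih by blast
    qed
  qed
qed

lemma reach_insert_both:
  assumes "p \<in> C" "q \<in> C" "p \<noteq> q"
  shows "insert (exit p (insert q (C - {p, q}))) (R (insert q (C - {p, q}))) = V - {t}"
proof -
  have "insert p (insert q (C - {p, q})) = C" using assms by auto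
  then show ?thesis
    using reach_insert[of "insert q (C - {p, q})" p] assms reach_all by auto
qed

text \<open>Only two vertices of \<open>V - {t}\<close> lie outside \<open>R (C - {p, q})\<close>.
  Adding \<open>q\<close> and then \<open>p\<close> supplies them one by one; after both, the path
  \<open>p\<close> can only go to \<open>t\<close>.\<close>

lemma last_vertices:
  assumes "p \<in> C" "q \<in> C" "p \<noteq> q" "exit p (C - {p, q}) = exit q (C - {p, q})"
    and "verts_of p = ys @ ps" "set ys \<subseteq> R (C - {p, q})" "set ps \<inter> R (C - {p, q}) = {}"
  shows "ps = [exit p (C - {p, q}), exit p (insert q (C - {p, q})), t]"
proof -
  let ?A = "C - {p, q}"
  let ?e = "exit p ?A" and ?w = "exit p (insert q ?A)"
  have "ps \<noteq> []"
    using assms path_last[of p] path_nonempty[of p] t_notin_reach[of ?A]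
    by (metis Diff_subset append_Nil2 last_in_set subsetD)
  then obtain ps' where ps: "ps = ?e # ps'"
    using exit_eqI[of p ys _ _ ?A] assms by (cases ps) auto
  have ins: "R (insert q ?A) = insert ?e (R ?A)"
    using reach_insert[of ?A q] assms by auto
  have "insert q ?A \<subseteq> C" "p \<in> C - insert q ?A" using assms by auto
  then obtain ys' zs where s: "verts_of p = ys' @ ?w # zs" "set ys' \<subseteq> R (insert q ?A)"
    "?w \<notin> R (insert q ?A)" "set zs \<inter> R (insert q ?A) = {}"
    by (metis exit_split)
  have d: "distinct (verts_of p)" using path_distinct assms by blast
  \<comment> \<open>\<open>ys'\<close> and \<open>ys @ [?e]\<close> are both the longest initial
    segment of the path inside the enlarged reach.\<close>
  have "ys' = takeWhile (\<lambda>v. v \<in> R (insert q ?A)) (verts_of p)"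
    using s by (simp add: takeWhile_append subset_code(1))
  moreover have "ys @ [?e] = takeWhile (\<lambda>v. v \<in> R (insert q ?A)) (verts_of p)"
  proof -
    have "set ps' \<inter> R (insert q ?A) = {}" using assms ps ins d by auto
    then have "takeWhile (\<lambda>v. v \<in> R (insert q ?A)) ps' = []" by (cases ps') auto
    then show ?thesis using assms ps ins by (auto simp: takeWhile_append)
  qed
  ultimately have ps': "ps' = ?w # zs" using s assms ps
    by (metis append.assoc append_Cons append_Nil same_append_eq)
  have all: "insert ?w (R (insert q ?A)) = V - {t}" using reach_insert_both[OF assms(1-3)] .
  \<comment> \<open>Beyond \<open>?w\<close> the path repeats no vertex and avoids the reach, while
    \<open>?w\<close> and the reach fill \<open>V - {t}\<close>.\<close>
  have "set zs \<subseteq> {t}"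
  proof
    fix z assume z: "z \<in> set zs"
    then have "z \<noteq> ?w" "z \<notin> R (insert q ?A)" using s(1,4) d by auto
    then have "z \<notin> V - {t}" unfolding all[symmetric] by simp
    moreover have "z \<in> V" using z s(1) path_V[OF assms(1)] by auto
    ultimately show "z \<in> {t}" by simp
  qed
  moreover have "distinct zs" using s(1) d by simp
  moreover have "zs \<noteq> []"
  proof
    assume "zs = []"
    then have "?w = t" using path_last[OF assms(1)] s(1) by simp
    moreover have "?w \<in> V - {t}" unfolding all[symmetric] by simp
    ultimately show False by simp
  qed
  ultimately have "zs = [t]" by (cases zs; cases "tl zs") auto
  then show ?thesis using ps ps' by simp
qed

text \<open>The paths share their part inside \<open>R (C - {p, q})\<close>, then the common exit,
  then the vertex identified by \<open>exit_swap\<close>, then \<open>t\<close>.\<close>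

lemma paths_eq:
  assumes "p \<in> C" "q \<in> C" "p \<noteq> q" "exit p {} = exit q {}"
  shows "verts_of p = verts_of q"
proof -
  let ?A = "C - {p, q}"
  have e: "exit p ?A = exit q ?A" using exit_eq_iff[of ?A p q] assms by auto
  obtain ys ps qs where ys: "verts_of p = ys @ ps" "verts_of q = ys @ qs" "set ys \<subseteq> R ?A"
    "set ps \<inter> R ?A = {}" "set qs \<inter> R ?A = {}"
    using common_prefix[of ?A p q] assms by auto
  have "ps = [exit p ?A, exit p (insert q ?A), t]"
    using last_vertices[of p q ys ps] ys assms e by auto
  moreover have "qs = [exit q ?A, exit q (insert p ?A), t]"
    using last_vertices[of q p ys qs] ys assms e by (auto simp: insert_commute)
  moreover have "exit p (insert q ?A) = exit q (insert p ?A)"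
    using exit_swap[of ?A p q] assms e by auto
  ultimately show ?thesis using ys e by simp
qed

section \<open>Different exits force disjoint paths\<close>

text \<open>The reach grows by exits of colors other than \<open>p\<close> and \<open>q\<close>.
  Such an exit on both paths would be the exit of each, although their exits differ.\<close>

lemma paths_disjoint_on_reach:
  assumes "A \<subseteq> C" "p \<in> C - A" "q \<in> C - A" "exit p {} \<noteq> exit q {}"
  shows "set (verts_of p) \<inter> set (verts_of q) \<inter> R A \<subseteq> {s}"
proof -
  have "finite A" using assms finite_C finite_subset by blast
  then show ?thesis
    using assms
  proof (induction A)
    case empty
    then show ?case using reach_empty by auto
  next
    case (insert r A)
    have "exit p A \<noteq> exit q A" using exit_eq_iff[of A p q] insert by auto
    then have "exit r A \<notin> set (verts_of p) \<inter> set (verts_of q)"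
      using exit_eq_if_on_path[of A p r] exit_eq_if_on_path[of A q r] insert by auto
    then show ?case using reach_insert[of A r] insert by auto
  qed
qed

text \<open>Outside the reach of the other colors there remain only \<open>t\<close> and the two
  exits, and each exit lies on only one of the paths.\<close>

lemma paths_disjoint:
  assumes "p \<in> C" "q \<in> C" "exit p {} \<noteq> exit q {}"
  shows "set (verts_of p) \<inter> set (verts_of q) \<subseteq> {s, t}"
proof
  fix v assume v: "v \<in> set (verts_of p) \<inter> set (verts_of q)"
  let ?A = "C - {p, q}"
  have pq: "p \<noteq> q" and mem: "?A \<subseteq> C" "p \<in> C - ?A" "q \<in> C - ?A" using assms by auto
  have e: "exit p ?A \<noteq> exit q ?A" using exit_eq_iff[of ?A p q] assms pq by auto
  then have "V - {t} = insert (exit p ?A) (insert (exit q ?A) (R ?A))"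
    using reach_insert_both[of p q] assms pq exit_insert_other[of ?A p q] reach_insert[of ?A q]
    by auto
  moreover have "v \<noteq> exit p ?A" "v \<noteq> exit q ?A"
    using exit_eq_if_on_path[of ?A p q] exit_eq_if_on_path[of ?A q p] mem pq e v by auto
  moreover have "v \<in> V" using v path_V assms by blast
  moreover have "v \<in> R ?A \<Longrightarrow> v = s"
    using paths_disjoint_on_reach[of ?A p q] mem v assms by blast
  ultimately show "v \<in> {s, t}" by blast
qed

lemma equal_or_disjoint:
  assumes "p \<in> C" "q \<in> C"
  shows "verts_of p = verts_of q \<or> set (verts_of p) \<inter> set (verts_of q) \<subseteq> {s, t}"
  using paths_eq paths_disjoint assms by metis

end

section \<open>Rainbow walks in a digraph\<close>

text \<open>A color is a path together with an index, which distinguishes the copies of that path.\<close>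

definition rainbow :: "('b list \<times> 'i) set \<Rightarrow> 'b list \<Rightarrow> bool" where
  "rainbow A w \<longleftrightarrow> (\<exists>f. inj_on f (set w) \<and> (\<forall>e \<in> set w. f e \<in> A \<and> e \<in> set (fst (f e))))"

lemma rainbow_Nil: "rainbow A []"
  by (simp add: rainbow_def)

lemma rainbow_mono: "rainbow A w \<Longrightarrow> A \<subseteq> B \<Longrightarrow> rainbow B w"
  unfolding rainbow_def by blast

lemma rainbow_subset:
  assumes "rainbow A w" "set v \<subseteq> set w"
  shows "rainbow A v"
  using assms unfolding rainbow_def by (meson inj_on_subset subsetD)

lemma rainbow_snoc:
  assumes "rainbow A w" "c \<notin> A" "e \<in> set (fst c)"
  shows "rainbow (insert c A) (w @ [e])"
proof (cases "e \<in> set w")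
  case True
  then show ?thesis
    using rainbow_subset[of "insert c A" w "w @ [e]"] rainbow_mono[OF assms(1)] by auto
next
  case False
  obtain f where f: "inj_on f (set w)" "\<forall>e \<in> set w. f e \<in> A \<and> e \<in> set (fst (f e))"
    using assms(1) unfolding rainbow_def by blast
  have "inj_on (f(e := c)) (set (w @ [e]))"
    using f assms(2) False by (auto simp: inj_on_def)
  moreover have "\<forall>a \<in> set (w @ [e]). (f(e := c)) a \<in> insert c A \<and> a \<in> set (fst ((f(e := c)) a))"
    using f assms(3) by auto
  ultimately show ?thesis unfolding rainbow_def by blast
qed

definition colors :: "'a multiset \<Rightarrow> ('a \<times> nat) set" where
  "colors M = (SIGMA x:set_mset M. {..<count M x})"

lemma finite_colors: "finite (colors M)"
  unfolding colors_def by auto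

lemma card_colors: "card (colors M) = size M"
  unfolding colors_def by (simp add: size_multiset_overloaded_eq)

lemma mem_colors_iff: "c \<in> colors M \<longleftrightarrow> snd c < count M (fst c)"
  unfolding colors_def by (cases c) (auto simp flip: count_greater_zero_iff)

lemma multicolored_iff_rainbow: "multicolored M q \<longleftrightarrow> rainbow (colors M) q"
  unfolding multicolored_def rainbow_def mem_colors_iff by simp

text \<open>There is a copy of \<open>p\<close> for each edge, so numbering the edges assigns them
  distinct copies. This bounds multiplicities when no path is multicolored.\<close>

lemma rainbow_colors_self:
  assumes "card (set p) \<le> count M p"
  shows "rainbow (colors M) p"
proof -
  obtain h where h: "bij_betw h (set p) {0..<card (set p)}"
    using ex_bij_betw_finite_nat[of "set p"] by blast
  then have "inj_on (\<lambda>e. (p, h e)) (set p)" by (auto simp: bij_betw_def inj_on_def)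
  moreover have "\<forall>e \<in> set p. (p, h e) \<in> colors M \<and> e \<in> set (fst (p, h e))"
    using bij_betw_apply[OF h] assms by (fastforce simp: mem_colors_iff)
  ultimately show ?thesis unfolding rainbow_def by blast
qed

section \<open>Vertex lists and rainbow reachability\<close>

lemma (in pre_digraph) consecutive_verts_arc:
  assumes "cas a p b" "awalk_verts a p = ys @ u # w # zs"
  obtains e where "e \<in> set p" "tail G e = u" "head G e = w"
proof -
  have "\<exists>e \<in> set p. tail G e = u \<and> head G e = w"
    using assms
  proof (induction p arbitrary: a ys)
    case (Cons e es)
    show ?case
    proof (cases ys)
      case Nil
      then have "tail G e = u" "awalk_verts (head G e) es = w # zs" using Cons.prems by auto
      moreover have "hd (awalk_verts (head G e) es) = head G e"
        using Cons.prems by (cases es) auto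
      ultimately show ?thesis by simp
    next
      case (Cons y ys')
      then show ?thesis using Cons.IH[of "head G e" ys'] Cons.prems by auto
    qed
  qed simp
  then show thesis using that by blast
qed

text \<open>The growth argument compares vertex lists only; the absence of parallel arcs turns their
  equality into equality of paths.\<close>

lemma (in nomulti_digraph) awalk_eq_if_awalk_verts_eq:
  assumes "awalk u p v" "awalk u q v" "awalk_verts u p = awalk_verts u q"
  shows "p = q"
  using assms
proof (induction p arbitrary: u q)
  case Nil
  then have "length (awalk_verts u []) = length (awalk_verts u q)" by (intro arg_cong[of _ _ length])
  then show ?case by (simp add: length_awalk_verts)
next
  case (Cons e es)
  then obtain d ds where q: "q = d # ds" by (cases q) auto
  have "awalk_verts (head G e) es = awalk_verts (head G d) ds" using Cons.prems q by simp
  moreover have "hd (awalk_verts (head G e) es) = head G e" "hd (awalk_verts (head G d) ds) = head G d"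
    using Cons.prems q by (auto simp: awalk_Cons_iff)
  ultimately have h: "head G e = head G d" by simp
  then have "e = d" using no_multi_arcs[of e d] Cons.prems q
    by (auto simp: awalk_Cons_iff arc_to_ends_def)
  moreover have "es = ds"
    using Cons.IH[of "head G e" ds] Cons.prems q h by (auto simp: awalk_Cons_iff)
  ultimately show ?case using q by simp
qed

text \<open>Walks replace paths here so that an edge can be appended even if it leads back to a
  visited vertex.\<close>

definition (in pre_digraph) rainbow_reach :: "'a \<Rightarrow> ('b awalk \<times> 'i) set \<Rightarrow> 'a set" where
  "rainbow_reach s A = {v. \<exists>w. awalk s w v \<and> rainbow A w}"

lemma (in wf_digraph) rainbow_reach_step:
  assumes "u \<in> rainbow_reach s A" "c \<notin> A" "awalk a (fst c) b"
    and "awalk_verts a (fst c) = ys @ u # w # zs"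
  shows "w \<in> rainbow_reach s (insert c A)"
proof -
  obtain e where e: "e \<in> set (fst c)" "tail G e = u" "head G e = w"
    using consecutive_verts_arc assms by blast
  obtain r where r: "awalk s r u" "rainbow A r" using assms unfolding rainbow_reach_def by blast
  have "awalk u [e] w" using e assms(3) arc_implies_awalk[of e] by auto
  then have "awalk s (r @ [e]) w" using r awalk_appendI by blast
  moreover have "rainbow (insert c A) (r @ [e])" using rainbow_snoc r(2) assms(2) e(1) .
  ultimately show ?thesis unfolding rainbow_reach_def by blast
qed

lemma (in wf_digraph) rainbow_apath_if_reach:
  assumes "t \<in> rainbow_reach s A"
  obtains q where "apath s q t" "rainbow A q"
  using assms apath_awalk_to_apath awalk_to_apath_subset rainbow_subset
  unfolding rainbow_reach_def by blast

section \<open>Counting inner vertices\<close>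

lemma (in wf_digraph) card_inner_verts:
  assumes "apath s p t" "s \<noteq> t"
  shows "card (set (awalk_verts s p) - {s, t}) = card (set p) - 1"
proof -
  have d: "distinct (awalk_verts s p)" and w: "awalk s p t" using assms by (auto simp: apath_def)
  then have "distinct p" by (auto intro: distinct_verts_imp_distinct)
  then have "card (set p) = length p" by (rule distinct_card)
  moreover have "card (set (awalk_verts s p)) = Suc (length p)"
    using d by (simp add: distinct_card length_awalk_verts)
  moreover have "{s, t} \<subseteq> set (awalk_verts s p)"
    using w by (metis awalkE' awalk_verts_non_Nil empty_subsetI hd_in_set insert_subset last_in_set)
  ultimately show ?thesis using assms(2) by (simp add: card_Diff_subset)
qed

lemma sum_list_replicate_mset_count:
  assumes "distinct ps" "set ps = set_mset M"
  shows "(\<Sum>p\<leftarrow>ps. replicate_mset (count M p) p) = M"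
proof (rule multiset_eqI)
  fix x
  have "count (\<Sum>p\<leftarrow>ps. replicate_mset (count M p) p) x = (\<Sum>p\<leftarrow>ps. count (replicate_mset (count M p) p) x)"
    by (induction ps) auto
  also have "\<dots> = (\<Sum>p\<in>set_mset M. if p = x then count M p else 0)"
    using assms by (simp add: sum_list_distinct_conv_sum_set)
  also have "\<dots> = count M x" by (auto simp: sum.delta' not_in_iff)
  finally show "count (\<Sum>p\<leftarrow>ps. replicate_mset (count M p) p) x = count M x" .
qed

text \<open>The inner vertex sets are disjoint, so the values \<open>card (set p) - 1\<close> sum to
  at most the number of inner vertices, which is the sum of the multiplicities. As no multiplicity
  exceeds its value, equality holds termwise.\<close>

lemma (in network) regimented_if_disjoint:
  assumes fin: "finite (verts G)"
    and path: "\<And>p. p \<in># \<P> \<Longrightarrow> apath s p t"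
    and size: "size \<P> = card (verts G - {s, t})"
    and disj: "\<And>p q. p \<in># \<P> \<Longrightarrow> q \<in># \<P> \<Longrightarrow> p \<noteq> q \<Longrightarrow> innerly_disjoint p q"
    and le: "\<And>p. p \<in># \<P> \<Longrightarrow> count \<P> p < card (set p)"
  shows "regimented \<P>"
proof -
  let ?I = "\<lambda>p. set (awalk_verts s p) - {s, t}"
  have "(\<Sum>p\<in>set_mset \<P>. card (set p) - 1) = (\<Sum>p\<in>set_mset \<P>. card (?I p))"
    using card_inner_verts path source_neq_sink by simp
  also have "\<dots> = card (\<Union>p\<in>set_mset \<P>. ?I p)"
    using disj unfolding innerly_disjoint_def by (intro card_UN_disjoint[symmetric]) auto
  also have "\<dots> \<le> card (verts G - {s, t})"
    using fin path by (intro card_mono) (auto simp: apath_def)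
  also have "\<dots> = (\<Sum>p\<in>set_mset \<P>. count \<P> p)"
    using size by (simp add: size_multiset_overloaded_eq)
  finally have ge: "(\<Sum>p\<in>set_mset \<P>. card (set p) - 1) \<le> (\<Sum>p\<in>set_mset \<P>. count \<P> p)" .
  have le': "count \<P> p \<le> card (set p) - 1" if "p \<in># \<P>" for p
    using le[OF that] by simp
  have eq: "count \<P> p = card (set p) - 1" if "p \<in># \<P>" for p
  proof (rule sum_mono_inv[OF _ le' that])
    show "(\<Sum>p\<in>set_mset \<P>. count \<P> p) = (\<Sum>p\<in>set_mset \<P>. card (set p) - 1)"
      using ge sum_mono[of "set_mset \<P>", OF le'] by (rule antisym[rotated])
  qed auto
  obtain ps where ps: "set ps = set_mset \<P>" "distinct ps"
    using finite_distinct_list[of "set_mset \<P>"] by auto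
  have "(\<Sum>p\<leftarrow>ps. replicate_mset (card (set p) - 1) p) = (\<Sum>p\<leftarrow>ps. replicate_mset (count \<P> p) p)"
    using eq ps by (intro arg_cong[of _ _ sum_list] map_cong) auto
  also have "\<dots> = \<P>" using sum_list_replicate_mset_count ps by blast
  finally have "\<P> = (\<Sum>p\<leftarrow>ps. replicate_mset (card (set p) - 1) p)" by simp
  moreover have "innerly_disjoint (ps ! i) (ps ! j)"
    if "i < length ps" "j < length ps" "i \<noteq> j" for i j
    using that ps disj nth_mem nth_eq_iff_index_eq by metis
  ultimately show ?thesis
    unfolding regimented_def using ps path by (intro exI[of _ ps]) auto
qed

theorem theorem3p3:
  fixes G :: "('a, 'b) pre_digraph" and s t :: 'a and \<P> :: "'b awalk multiset"
  assumes "network G s t"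
    and "fin_digraph G"
    and "\<And>p. p \<in># \<P> \<Longrightarrow> pre_digraph.apath G s p t"
    and "size \<P> = card (verts G - {s, t})"
    and "\<not> network.regimented G s t \<P>"
  shows "\<exists>q. pre_digraph.apath G s q t \<and> multicolored \<P> q"
proof (rule ccontr)
  interpret network G s t by fact
  interpret fin_digraph G by fact
  assume "\<nexists>q. apath s q t \<and> multicolored \<P> q"
  then have no: "\<not> rainbow (colors \<P>) q" if "apath s q t" for q
    using that multicolored_iff_rainbow by blast
  have path: "apath s (fst c) t" if "c \<in> colors \<P>" for c
    using that assms(3) unfolding colors_def by auto
  interpret stalled_growth "verts G" s t "colors \<P>" "\<lambda>c. awalk_verts s (fst c)" "rainbow_reach s"
  proof
    fix A :: "('b awalk \<times> nat) set" assume A: "A \<subseteq> colors \<P>"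
    show "s \<in> rainbow_reach s A"
      unfolding rainbow_reach_def using awalk_Nil_iff rainbow_Nil source_in_verts by blast
    \<comment> \<open>A rainbow walk to \<open>t\<close> would shorten to a path with colors from
      \<open>A\<close>, which is multicolored.\<close>
    have "t \<notin> rainbow_reach s A"
      using no rainbow_mono[OF _ A] by (metis rainbow_apath_if_reach)
    then show "rainbow_reach s A \<subseteq> verts G - {t}"
      unfolding rainbow_reach_def by auto
  next
    fix A B :: "('b awalk \<times> nat) set" assume "A \<subseteq> B"
    then show "rainbow_reach s A \<subseteq> rainbow_reach s B"
      unfolding rainbow_reach_def using rainbow_mono by blast
  next
    fix A :: "('b awalk \<times> nat) set" and c ys u w zs
    assume "c \<in> colors \<P> - A" "awalk_verts s (fst c) = ys @ u # w # zs" "u \<in> rainbow_reach s A"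
    then show "w \<in> rainbow_reach s (insert c A)"
      using rainbow_reach_step path by (metis Diff_iff awalkI_apath)
  next
    fix c assume "c \<in> colors \<P>"
    then have p: "apath s (fst c) t" by (rule path)
    show "hd (awalk_verts s (fst c)) = s" "last (awalk_verts s (fst c)) = t"
      "distinct (awalk_verts s (fst c))" "set (awalk_verts s (fst c)) \<subseteq> verts G"
      using p by (auto simp: apath_def)
  qed (auto simp: source_neq_sink sink_in_verts finite_colors card_colors assms(4))
  \<comment> \<open>Copy number 0 exists for every member and serves as its representative
    color.\<close>
  have in_colors: "(p, 0) \<in> colors \<P>" if "p \<in># \<P>" for p
    using that by (simp add: mem_colors_iff)
  have "innerly_disjoint p q" if "p \<in># \<P>" "q \<in># \<P>" "p \<noteq> q" for p q
    using equal_or_disjoint[OF in_colors in_colors, of p q] that assms(3)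
      awalk_eq_if_awalk_verts_eq[of s p t q]
    unfolding innerly_disjoint_def by (auto dest: awalkI_apath)
  \<comment> \<open>Otherwise \<open>p\<close> would be multicolored by its own copies.\<close>
  moreover have "count \<P> p < card (set p)" if "p \<in># \<P>" for p
    using no assms(3)[OF that] rainbow_colors_self not_le by blast
  ultimately have "regimented \<P>"
    using regimented_if_disjoint assms(3,4) finite_verts by blast
  then show False using assms(5) by blast
qed

end
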